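(* Let $\theta>1$ be a real number and let $\Lambda\subset\mathbb{R}^n$ be a Meyer set such that $\Lambda\supset\theta\Lambda$. Then there is a finite set $F\subset\mathbb{R}^n$ with $\Lambda\subseteq\theta\Lambda+F$.
   Context: A set $\Lambda\subset\mathbb{R}^n$ is uniformly discrete if $\inf\{|x-y| : x,y\in\Lambda,\ x\ne y\}>0$. It is relatively dense if there is $R>0$ such that for every $x\in\mathbb{R}^n$ there is $\lambda\in\Lambda$ with $|x-\lambda|\le R$. A Delone set is a uniformly discrete and relatively dense set. A Delone set $\Lambda\subset\mathbb{R}^n$ is a Meyer set if there is a finite set $E\subset\mathbb{R}^n$ with $\Lambda-\Lambda\subset\Lambda+E$, where $\Lambda-\Lambda=\{x-y : x,y\in\Lambda\}$. Notation: $\theta\Lambda=\{\theta x : x\in\Lambda\}$ and $A+B=\{a+b : a\in A,\ b\in B\}$. *)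

theory Defs
  imports "HOL-Analysis.Analysis" "HOL-Library.Set_Algebras"
begin

(* "uniform_discrete" is the library's predicate "EX e > 0. ALL x : S. ALL y : S. dist x y < e --> x = y",
   i.e. the infimum of the distances between distinct points of S is positive (with inf {} = infinity). *)

definition relatively_dense :: "(real ^ 'n) set \<Rightarrow> bool" where
  "relatively_dense \<Lambda> \<longleftrightarrow> (\<exists>R>0. \<forall>x. \<exists>l\<in>\<Lambda>. norm (x - l) \<le> R)"

definition delone_set :: "(real ^ 'n) set \<Rightarrow> bool" where
  "delone_set \<Lambda> \<longleftrightarrow> uniform_discrete \<Lambda> \<and> relatively_dense \<Lambda>"

(* The Minkowski difference is written out because "-" on sets is the set-theoretic difference;
   "+" on sets is the Minkowski sum of Set_Algebras. *)
definition meyer_set :: "(real ^ 'n) set \<Rightarrow> bool" where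
  "meyer_set \<Lambda> \<longleftrightarrow>
     delone_set \<Lambda> \<and> (\<exists>E. finite E \<and> {x - y | x y. x \<in> \<Lambda> \<and> y \<in> \<Lambda>} \<subseteq> \<Lambda> + E)"

end

theory Submission
  imports Defs
begin

text \<open>
  Given \<open>x \<in> \<Lambda>\<close>, choose a point \<open>l \<in> \<Lambda>\<close> within the covering radius \<open>R\<close> of \<open>x / \<theta>\<close>; rescaling,
  the remainder \<open>x - \<theta> l\<close> has norm at most \<open>\<theta> R\<close>. Since \<open>\<theta> \<Lambda> \<subseteq> \<Lambda>\<close>, this remainder is also
  a difference of two points of \<open>\<Lambda>\<close>, so the Meyer property puts it in \<open>\<Lambda> + E\<close> with \<open>E\<close> finite.
  A finite union of translates of a uniformly discrete set meets every ball in finitely many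
  points, so the part of \<open>\<Lambda> + E\<close> in the ball of radius \<open>\<theta> R\<close> around the origin serves as \<open>F\<close>.
\<close>

text \<open>
  The part of each translate \<open>S + e\<close> in the ball around the origin is a copy of the part of \<open>S\<close>
  in the ball around \<open>- e\<close>, and bounded uniformly discrete sets are finite.
\<close>

lemma finite_uniform_discrete_plus_finite_Int_cball:
  fixes S E :: "'a::euclidean_space set"
  assumes "uniform_discrete S" and "finite E"
  shows "finite ((S + E) \<inter> cball 0 r)"
proof -
  have "finite (S \<inter> cball (- e) r)" for e
  proof -
    have "uniform_discrete (S \<inter> cball (- e) r)"
      using assms(1) unfolding uniform_discrete_def by blast
    then show ?thesis
      using uniform_discrete_finite_iff bounded_cball by (meson bounded_Int)
  qed
  then have "finite (\<Union>e\<in>E. (\<lambda>s. s + e) ` (S \<inter> cball (- e) r))"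
    using assms(2) by blast
  moreover have "(S + E) \<inter> cball 0 r \<subseteq> (\<Union>e\<in>E. (\<lambda>s. s + e) ` (S \<inter> cball (- e) r))"
  proof
    fix z assume "z \<in> (S + E) \<inter> cball 0 r"
    then obtain s e where "s \<in> S" "e \<in> E" "z = s + e" "norm (s + e) \<le> r"
      by (auto elim!: set_plus_elim)
    moreover from this have "s \<in> cball (- e) r"
      by (simp add: dist_norm norm_minus_commute add.commute)
    ultimately show "z \<in> (\<Union>e\<in>E. (\<lambda>s. s + e) ` (S \<inter> cball (- e) r))"
      by blast
  qed
  ultimately show ?thesis
    by (rule rev_finite_subset)
qed

theorem proposition1:
  fixes \<theta> :: real and \<Lambda> :: "(real ^ 'n) set"
  assumes "\<theta> > 1"
    and "meyer_set \<Lambda>"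
    and "(\<lambda>x. \<theta> *\<^sub>R x) ` \<Lambda> \<subseteq> \<Lambda>"
  shows "\<exists>F :: (real ^ 'n) set. finite F \<and> \<Lambda> \<subseteq> (\<lambda>x. \<theta> *\<^sub>R x) ` \<Lambda> + F"
proof -
  obtain E where E: "finite E" "{x - y | x y. x \<in> \<Lambda> \<and> y \<in> \<Lambda>} \<subseteq> \<Lambda> + E"
    using assms(2) unfolding meyer_set_def by blast
  have discrete: "uniform_discrete \<Lambda>" and "relatively_dense \<Lambda>"
    using assms(2) unfolding meyer_set_def delone_set_def by auto
  then obtain R where R: "\<And>x. \<exists>l\<in>\<Lambda>. norm (x - l) \<le> R"
    unfolding relatively_dense_def by blast
  define F where "F = (\<Lambda> + E) \<inter> cball 0 (\<theta> * R)"
  have "finite F"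
    unfolding F_def using discrete E(1) by (rule finite_uniform_discrete_plus_finite_Int_cball)
  moreover have "\<Lambda> \<subseteq> (\<lambda>x. \<theta> *\<^sub>R x) ` \<Lambda> + F"
  proof
    fix x assume x: "x \<in> \<Lambda>"
    obtain l where l: "l \<in> \<Lambda>" "norm ((1 / \<theta>) *\<^sub>R x - l) \<le> R"
      using R by blast
    have "x - \<theta> *\<^sub>R l = \<theta> *\<^sub>R ((1 / \<theta>) *\<^sub>R x - l)"
      using assms(1) by (simp add: scaleR_diff_right)
    then have "norm (x - \<theta> *\<^sub>R l) \<le> \<theta> * R"
      using l(2) assms(1) by simp
    moreover have "x - \<theta> *\<^sub>R l \<in> \<Lambda> + E"
      using E(2) x l(1) assms(3) by blast
    ultimately have "x - \<theta> *\<^sub>R l \<in> F"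
      unfolding F_def by simp
    then have "\<theta> *\<^sub>R l + (x - \<theta> *\<^sub>R l) \<in> (\<lambda>x. \<theta> *\<^sub>R x) ` \<Lambda> + F"
      using l(1) by (intro set_plus_intro) auto
    then show "x \<in> (\<lambda>x. \<theta> *\<^sub>R x) ` \<Lambda> + F"
      by simp
  qed
  ultimately show ?thesis
    by blast
qed

end
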